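(* Let $(X,G)$ be a CR-dynamical system such that $\operatorname{trans}_2(G)\neq\emptyset$. If $X$ has no isolated points, then $(X,G)$ is transitive.
   Context: A CR-dynamical system is a pair $(X,G)$ where $X$ is a non-empty compact metric space and $G$ is a closed relation on $X$, i.e. a non-empty closed subset of $X\times X$. For a positive integer $n$ and $x\in X$, $G^n(x)$ is the set of all $y\in X$ for which there are $x_1,\dots,x_{n+1}\in X$ with $x_1=x$, $x_{n+1}=y$ and $(x_i,x_{i+1})\in G$ for $1\le i\le n$; for $A\subseteq X$, $G^n(A)=\bigcup_{x\in A}G^n(x)$, and $G^0(A)=A$. $(X,G)$ is transitive if for all non-empty open sets $U,V$ in $X$ there is a non-negative integer $n$ with $G^n(U)\cap V\neq\emptyset$. A trajectory of $x\in X$ is an infinite sequence $(x_1,x_2,x_3,\ldots)$ in $X$ with $x_1=x$ and $(x_i,x_{i+1})\in G$ for every positive integer $i$. $\operatorname{trans}_2(G)$ is the set of 2-transitive points: those $x\in X$ having at least one trajectory $(x_1,x_2,\ldots)$ whose orbit $\{x_k : k\ge 1\}$ is dense in $X$. *)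

theory Defs
  imports "HOL-Analysis.Analysis"
begin

text \<open>
  The space is a set \<open>X\<close> in an ambient metric space type, with the induced metric; openness and
  closedness in \<open>X\<close> and in \<open>X \<times> X\<close> refer to the subspace topology.
\<close>

definition CR_dynamical_system :: "'a::metric_space set \<Rightarrow> ('a \<times> 'a) set \<Rightarrow> bool" where
  "CR_dynamical_system X G \<longleftrightarrow>
     X \<noteq> {} \<and> compact X \<and> G \<noteq> {} \<and> closedin (top_of_set (X \<times> X)) G"

text \<open>
  Finite and infinite sequences \<open>x\<^sub>1, x\<^sub>2, \<dots>\<close> are represented by functions on \<open>nat\<close> with indices
  shifted by one, so that they start at \<open>x 0\<close>.
\<close>

definition iter_image :: "'a set \<Rightarrow> ('a \<times> 'a) set \<Rightarrow> nat \<Rightarrow> 'a set \<Rightarrow> 'a set" where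
  "iter_image X G n A =
     (if n = 0 then A
      else (\<Union>a\<in>A. {y. \<exists>x :: nat \<Rightarrow> 'a. x 0 = a \<and> x n = y \<and>
                          (\<forall>i\<le>n. x i \<in> X) \<and> (\<forall>i<n. (x i, x (Suc i)) \<in> G)}))"

definition CR_transitive :: "'a::metric_space set \<Rightarrow> ('a \<times> 'a) set \<Rightarrow> bool" where
  "CR_transitive X G \<longleftrightarrow>
     (\<forall>U V. openin (top_of_set X) U \<and> U \<noteq> {} \<and> openin (top_of_set X) V \<and> V \<noteq> {} \<longrightarrow>
        (\<exists>n. iter_image X G n U \<inter> V \<noteq> {}))"

definition trajectory :: "'a set \<Rightarrow> ('a \<times> 'a) set \<Rightarrow> 'a \<Rightarrow> (nat \<Rightarrow> 'a) \<Rightarrow> bool" where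
  "trajectory X G a x \<longleftrightarrow>
     x 0 = a \<and> (\<forall>i. x i \<in> X) \<and> (\<forall>i. (x i, x (Suc i)) \<in> G)"

definition trans2 :: "'a::metric_space set \<Rightarrow> ('a \<times> 'a) set \<Rightarrow> 'a set" where
  "trans2 X G =
     {a \<in> X. \<exists>x. trajectory X G a x \<and> (top_of_set X) closure_of (range x) = X}"

end

theory Submission
  imports Defs
begin

text \<open>
  A dense orbit visits every non-empty open set \<open>V\<close>. Without isolated points, removing the finitely
  many points of an initial segment of the orbit leaves \<open>V\<close> open and non-empty, so the
  orbit visits \<open>V\<close> at arbitrarily late times. Hence, given \<open>U\<close> and \<open>V\<close>, the orbit enters \<open>U\<close> at
  some time and is in \<open>V\<close> then or later; the piece of the trajectory in between witnesses
  transitivity.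
\<close>

lemma openin_Diff_finite_nonempty:
  fixes X :: "'a::metric_space set"
  assumes perfect: "\<not> (\<exists>x. x isolated_in X)"
    and V: "openin (top_of_set X) V" "V \<noteq> {}"
    and "finite F"
  shows "openin (top_of_set X) (V - F)" "V - F \<noteq> {}"
proof -
  obtain T where T: "open T" "V = X \<inter> T"
    using V(1) by (auto simp: openin_open)
  have "V - F = X \<inter> (T - F)"
    using T(2) by auto
  moreover have "open (T - F)"
    using T(1) \<open>finite F\<close> by (simp add: open_Diff finite_imp_closed)
  ultimately show "openin (top_of_set X) (V - F)"
    by (simp add: openin_open_Int)
  obtain v where v: "v \<in> X" "v \<in> T"
    using V(2) T(2) by auto
  then have "v islimpt X"
    using perfect isolated_in_islimpt_iff by blast
  \<comment> \<open>A limit point of \<open>X\<close> has infinitely many points of \<open>X\<close> in each of its neighbourhoods.\<close>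
  then have "infinite (X \<inter> T)"
    using T(1) v(2) by (auto simp: islimpt_eq_acc_point Int_commute)
  then show "V - F \<noteq> {}"
    using T(2) \<open>finite F\<close> by (metis Diff_eq_empty_iff finite_subset)
qed

text \<open>
  The points to be avoided are those visited before time \<open>m\<close>: a visit to \<open>V\<close> outside of them
  cannot take place before time \<open>m\<close>.
\<close>

lemma dense_sequence_visits_openin_late:
  fixes X :: "'a::metric_space set" and x :: "nat \<Rightarrow> 'a"
  assumes perfect: "\<not> (\<exists>x. x isolated_in X)"
    and dense: "(top_of_set X) closure_of (range x) = X"
    and V: "openin (top_of_set X) V" "V \<noteq> {}"
  obtains n where "n \<ge> m" "x n \<in> V"
proof -
  let ?W = "V - x ` {..<m}"
  have W: "openin (top_of_set X) ?W" "?W \<noteq> {}"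
    using openin_Diff_finite_nonempty[OF perfect V] by simp_all
  then obtain w where "w \<in> ?W" "w \<in> (top_of_set X) closure_of (range x)"
    using dense openin_imp_subset[OF W(1)] by blast
  then obtain n where "x n \<in> ?W"
    using W(1) by (auto simp: in_closure_of)
  then show thesis
    by (intro that[of n]) (auto simp: not_less[symmetric])
qed

lemma trajectory_in_iter_image:
  assumes "trajectory X G a x" and "m \<le> n" and "x m \<in> A"
  shows "x n \<in> iter_image X G (n - m) A"
proof (cases "m = n")
  case True
  then show ?thesis
    using assms(3) by (simp add: iter_image_def)
next
  case False
  have "\<exists>y. y 0 = x m \<and> y (n - m) = x n \<and>
      (\<forall>i\<le>n - m. y i \<in> X) \<and> (\<forall>i<n - m. (y i, y (Suc i)) \<in> G)"
    using assms(1,2) by (intro exI[of _ "\<lambda>i. x (m + i)"]) (simp add: trajectory_def)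
  then show ?thesis
    using False assms(2,3) by (auto simp: iter_image_def)
qed

theorem theorem7p15:
  fixes X :: "'a::metric_space set" and G :: "('a \<times> 'a) set"
  assumes "CR_dynamical_system X G"
    and "trans2 X G \<noteq> {}"
    and "\<not> (\<exists>x. x isolated_in X)"
  shows "CR_transitive X G"
  unfolding CR_transitive_def
proof (intro allI impI, elim conjE)
  fix U V
  assume U: "openin (top_of_set X) U" "U \<noteq> {}" and V: "openin (top_of_set X) V" "V \<noteq> {}"
  obtain a x where x: "trajectory X G a x"
    and dense: "(top_of_set X) closure_of (range x) = X"
    using assms(2) by (auto simp: trans2_def)
  obtain m where m: "x m \<in> U"
    using dense_sequence_visits_openin_late[OF assms(3) dense U, of 0] by blast
  obtain n where n: "m \<le> n" "x n \<in> V"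
    using dense_sequence_visits_openin_late[OF assms(3) dense V] by blast
  have "x n \<in> iter_image X G (n - m) U"
    using trajectory_in_iter_image[OF x n(1) m] .
  then show "\<exists>n. iter_image X G n U \<inter> V \<noteq> {}"
    using n(2) by blast
qed

end
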